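(* Let $G$ be a finite group. Then $\mathcal{RP}(G)\ncong C_n$ and $\mathcal{RP}^*(G)\ncong C_n$ for any $n\ge 3$.
   Context: For a group $G$ with identity $e$, the reduced power graph $\mathcal{RP}(G)$ is the simple graph with vertex set $G$ in which $u,v$ are adjacent if and only if $\langle v\rangle\subset\langle u\rangle$ or $\langle u\rangle\subset\langle v\rangle$, where $\subset$ means proper inclusion. The proper reduced power graph $\mathcal{RP}^*(G)$ is the subgraph of $\mathcal{RP}(G)$ induced on $G\setminus\{e\}$. $C_n$ denotes the cycle of length $n$. *)

theory Defs
  imports
    "HOL-Algebra.Generated_Groups"
    "Graph_Theory.Graph_Theory"
begin

text \<open>
  A simple graph is a symmetric loop-free digraph whose arcs are pairs of vertices
  (locale \<^locale>\<open>pair_graph\<close>); an edge \<open>{u, v}\<close> is the pair of arcs \<open>(u, v)\<close> and \<open>(v, u)\<close>.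
  On such graphs \<^const>\<open>digraph_iso\<close> is isomorphism of simple graphs, since an arc is determined
  by its end points.
\<close>

definition reduced_power_graph :: "('a, 'b) monoid_scheme \<Rightarrow> 'a pair_pre_digraph" where
  "reduced_power_graph G =
    \<lparr> pverts = carrier G,
      parcs = {(u, v). u \<in> carrier G \<and> v \<in> carrier G \<and>
        (generate G {v} \<subset> generate G {u} \<or> generate G {u} \<subset> generate G {v})} \<rparr>"

definition proper_reduced_power_graph ::
    "('a, 'b) monoid_scheme \<Rightarrow> ('a, 'a \<times> 'a) pre_digraph" where
  "proper_reduced_power_graph G =
    with_proj (reduced_power_graph G) \<restriction> (carrier G - {\<one>\<^bsub>G\<^esub>})"

text \<open>Only meaningful for \<open>n \<ge> 3\<close>: for \<open>n = 1\<close> the formula yields a loop.\<close>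

definition cycle_graph :: "nat \<Rightarrow> nat pair_pre_digraph" where
  "cycle_graph n =
    \<lparr> pverts = {..<n},
      parcs = {(i, j). i < n \<and> j < n \<and> (j = (i + 1) mod n \<or> i = (j + 1) mod n)} \<rparr>"

lemma pair_graph_reduced_power_graph:
  assumes "finite (carrier G)"
  shows "pair_graph (reduced_power_graph G)"
proof
  show "finite (parcs (reduced_power_graph G))"
    by (rule finite_subset[of _ "carrier G \<times> carrier G"])
      (use assms in \<open>auto simp: reduced_power_graph_def\<close>)
qed (use assms in \<open>auto simp: reduced_power_graph_def symmetric_def sym_def\<close>)

lemma graph_proper_reduced_power_graph:
  assumes "finite (carrier G)"
  shows "graph (proper_reduced_power_graph G)"
proof -
  interpret R: pair_graph "reduced_power_graph G"
    using assms by (rule pair_graph_reduced_power_graph)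
  have "induced_subgraph (proper_reduced_power_graph G) (with_proj (reduced_power_graph G))"
    unfolding proper_reduced_power_graph_def
    by (rule R.induced_induce) (auto simp: reduced_power_graph_def)
  then interpret S: sym_digraph "proper_reduced_power_graph G"
    by (rule R.induced_graph_imp_graph)
  show ?thesis
  proof
    show "finite (verts (proper_reduced_power_graph G))"
      using assms by (simp add: proper_reduced_power_graph_def)
    show "finite (arcs (proper_reduced_power_graph G))"
      using R.finite_arcs by (simp add: proper_reduced_power_graph_def)
  qed (use R.no_loops in \<open>auto simp: proper_reduced_power_graph_def arc_to_ends_def\<close>)
qed

lemma pair_graph_cycle_graph:
  assumes "n \<ge> 3"
  shows "pair_graph (cycle_graph n)"
proof
  show "finite (parcs (cycle_graph n))"
    by (rule finite_subset[of _ "{..<n} \<times> {..<n}"]) (auto simp: cycle_graph_def)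
  show "fst e \<noteq> snd e" if "e \<in> parcs (cycle_graph n)" for e
    using that assms by (auto simp: cycle_graph_def mod_Suc split: if_splits)
qed (auto simp: cycle_graph_def symmetric_def sym_def)

end

theory Submission
  imports Defs "HOL-Computational_Algebra.Primes"
begin

text \<open>
  Every vertex of a cycle of length at least 3 has exactly two neighbours, and neither power graph
  can have this property.

  In the full reduced power graph the identity is adjacent to all other elements, so if it has
  degree 2 then the group has order 3. By Lagrange's theorem every element \<open>x \<noteq> \<one>\<close> then generates
  the whole group, and is adjacent to \<open>\<one>\<close> only.

  In the proper reduced power graph pick an edge, given by \<open>\<one> \<noteq> a\<close> and
  \<open>\<langle>a\<rangle> \<subset> \<langle>v\<rangle>\<close>. Elements generating the same subgroup have the same neighbours, so \<open>v\<close> and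
  \<open>v\<^sup>-\<^sup>1\<close> are both adjacent to \<open>a\<close>. They are distinct, because \<open>\<langle>v\<rangle>\<close> has more than two
  elements, so they are the two neighbours of \<open>a\<close>. In particular every element above \<open>v\<close>, and every
  generator of \<open>\<langle>v\<rangle>\<close>, is one of \<open>v\<close> and \<open>v\<^sup>-\<^sup>1\<close>. Hence the second neighbour \<open>c\<close> of \<open>v\<close> lies in
  \<open>\<langle>v\<rangle>\<close>, and \<open>\<langle>v\<rangle> = {\<one>, a, c, v, v\<^sup>-\<^sup>1}\<close> has order 5. A group of prime order has no
  subgroup strictly between the trivial one and itself, which contradicts the existence of \<open>a\<close>.
\<close>

section \<open>Degrees under isomorphism with a cycle\<close>

lemma out_degree_cycle_graph:
  assumes "n \<ge> 3" and "i < n"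
  shows "out_degree (with_proj (cycle_graph n)) i = 2"
proof -
  define p where "p = (if i = 0 then n - 1 else i - 1)"
  have "out_arcs (with_proj (cycle_graph n)) i = {(i, (i + 1) mod n), (i, p)}"
    using assms by (auto simp: out_arcs_def cycle_graph_def p_def mod_Suc split: if_splits)
  moreover have "(i + 1) mod n \<noteq> p"
    using assms by (auto simp: p_def mod_Suc)
  ultimately show ?thesis
    by (simp add: out_degree_def)
qed

lemma out_degree_of_iso_cycle_graph:
  assumes "digraph_iso D (with_proj (cycle_graph n))" and "n \<ge> 3" and "u \<in> verts D"
  shows "out_degree D u = 2"
proof -
  obtain f where f: "pre_digraph.digraph_isomorphism D f"
    and C: "with_proj (cycle_graph n) = app_iso f D"
    using assms(1) by (auto simp: digraph_iso_def)
  have "wf_digraph D"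
    using f by (simp add: pre_digraph.digraph_isomorphism_def)
  then have "out_degree (with_proj (cycle_graph n)) (iso_verts f u) = out_degree D u"
    using f assms(3) by (simp add: C wf_digraph.out_degree_app_iso_eq)
  moreover have "iso_verts f u \<in> verts (with_proj (cycle_graph n))"
    using assms(3) by (simp add: C)
  then have "iso_verts f u < n"
    by (simp add: cycle_graph_def)
  ultimately show ?thesis
    using out_degree_cycle_graph[OF assms(2)] by simp
qed

lemma verts_nonempty_of_iso_cycle_graph:
  assumes "digraph_iso D (with_proj (cycle_graph n))" and "n \<ge> 3"
  shows "verts D \<noteq> {}"
proof -
  obtain f where "with_proj (cycle_graph n) = app_iso f D"
    using assms(1) by (auto simp: digraph_iso_def)
  then have "iso_verts f ` verts D = verts (with_proj (cycle_graph n))"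
    by simp
  moreover have "0 \<in> verts (with_proj (cycle_graph n))"
    using assms(2) by (simp add: cycle_graph_def)
  ultimately show ?thesis
    by auto
qed

section \<open>Degrees in the reduced power graphs\<close>

lemma out_degree_reduced_power_graph:
  assumes "u \<in> carrier G"
  shows "out_degree (with_proj (reduced_power_graph G)) u =
    card {w \<in> carrier G. generate G {w} \<subset> generate G {u} \<or> generate G {u} \<subset> generate G {w}}"
    (is "_ = card ?N")
proof -
  have "out_arcs (with_proj (reduced_power_graph G)) u = Pair u ` ?N"
    using assms unfolding out_arcs_def reduced_power_graph_def by (simp add: set_eq_iff image_iff) metis
  then show ?thesis
    by (simp add: out_degree_def card_image inj_on_def)
qed

lemma out_degree_proper_reduced_power_graph:
  assumes "u \<in> carrier G - {\<one>\<^bsub>G\<^esub>}"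
  shows "out_degree (proper_reduced_power_graph G) u =
    card {w \<in> carrier G - {\<one>\<^bsub>G\<^esub>}.
      generate G {w} \<subset> generate G {u} \<or> generate G {u} \<subset> generate G {w}}"
    (is "_ = card ?N")
proof -
  have "out_arcs (proper_reduced_power_graph G) u = Pair u ` ?N"
    using assms unfolding out_arcs_def proper_reduced_power_graph_def reduced_power_graph_def
    by (simp add: set_eq_iff image_iff) metis
  then show ?thesis
    by (simp add: out_degree_def card_image inj_on_def)
qed

section \<open>Neither reduced power graph is 2-regular\<close>

context group
begin

lemma card_subgroup_dvd_card_subgroup:
  assumes "subgroup H G" and "subgroup K G" and "K \<subseteq> H"
  shows "card K dvd card H"
proof -
  interpret H: group "G\<lparr>carrier := H\<rparr>"
    using assms(1) by (rule subgroup_imp_group)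
  have "card (rcosets\<^bsub>G\<lparr>carrier := H\<rparr>\<^esub> K) * card K = card H"
    using H.lagrange[OF subgroup_incl[OF assms(2,1,3)]] by (simp add: order_def)
  then show ?thesis
    by (metis dvd_triv_right)
qed

lemma subgroup_of_prime_card:
  assumes "subgroup H G" and "prime (card H)" and "subgroup K G" and "K \<subseteq> H"
  shows "K = {\<one>} \<or> K = H"
proof -
  have fin: "finite H"
    using prime_gt_0_nat[OF assms(2)] by (rule card_ge_0_finite)
  have "card K = 1 \<or> card K = card H"
    using card_subgroup_dvd_card_subgroup[OF assms(1,3,4)] assms(2) unfolding prime_nat_iff by blast
  moreover have "K = {\<one>}" if "card K = 1"
    using that subgroup.one_closed[OF assms(3)] by (auto simp: card_1_singleton_iff)
  ultimately show ?thesis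
    using card_subset_eq[OF fin assms(4)] by blast
qed

lemma generate_one: "generate G {\<one>} = {\<one>}"
  using generate_subgroup_incl[of "{\<one>}" "{\<one>}"] triv_subgroup generate.one[of G] by auto

lemma generate_inv:
  assumes "v \<in> carrier G"
  shows "generate G {inv v} = generate G {v}"
proof -
  have "generate G {inv x} \<subseteq> generate G {x}" if "x \<in> carrier G" for x
    using that by (intro generate_subgroup_incl generate_is_subgroup) (auto intro: generate.inv)
  from this[of v] this[of "inv v"] show ?thesis
    using assms by auto
qed

lemma generate_subset_iff:
  assumes "x \<in> carrier G" and "y \<in> carrier G"
  shows "generate G {x} \<subseteq> generate G {y} \<longleftrightarrow> x \<in> generate G {y}"
proof
  show "x \<in> generate G {y}" if "generate G {x} \<subseteq> generate G {y}"
    using that by (auto intro: generate.incl)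
  show "generate G {x} \<subseteq> generate G {y}" if "x \<in> generate G {y}"
    using that assms(2) by (intro generate_subgroup_incl generate_is_subgroup) auto
qed

lemma generate_involution:
  assumes "v \<in> carrier G" and "inv v = v"
  shows "generate G {v} \<subseteq> {\<one>, v}"
proof (rule generate_subgroup_incl)
  have "v \<otimes> v = \<one>"
    using r_inv[OF assms(1)] assms(2) by simp
  then show "subgroup {\<one>, v} G"
    using assms by unfold_locales auto
qed simp

lemma reduced_power_graph_not_2_regular:
  assumes fin: "finite (carrier G)"
    and deg: "\<And>u. u \<in> carrier G \<Longrightarrow>
      card {w \<in> carrier G. generate G {w} \<subset> generate G {u} \<or> generate G {u} \<subset> generate G {w}} = 2"
  shows False
proof -
  have one_below: "{\<one>} \<subset> generate G {w}" if "w \<noteq> \<one>" for w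
    using that generate.one[of G "{w}"] generate.incl[of w "{w}" G] by auto
  have "{w \<in> carrier G. generate G {w} \<subset> generate G {\<one>} \<or> generate G {\<one>} \<subset> generate G {w}}
      = carrier G - {\<one>}"
    using one_below generate_one by (auto dest: psubsetD)
  then have c2: "card (carrier G - {\<one>}) = 2"
    using deg[of \<one>] by simp
  then have "card (carrier G) = 3"
    using fin by (simp add: card_Diff_singleton)
  then have prime: "prime (card (carrier G))"
    by simp
  have full: "generate G {w} = carrier G" if "w \<in> carrier G" "w \<noteq> \<one>" for w
    using subgroup_of_prime_card[OF subgroup_self prime, of "generate G {w}"]
      generate_is_subgroup[of "{w}"] generate_incl[of "{w}"] one_below[of w] that by auto
  obtain x where x: "x \<in> carrier G" "x \<noteq> \<one>"
    using c2 by (metis card.empty Diff_iff all_not_in_conv insertI1 zero_neq_numeral)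
  have "{w \<in> carrier G. generate G {w} \<subset> generate G {x} \<or> generate G {x} \<subset> generate G {w}} \<subseteq> {\<one>}"
    using full x by auto
  from card_mono[OF _ this] show False
    using deg[OF x(1)] by simp
qed

lemma proper_reduced_power_graph_not_2_regular:
  assumes nonempty: "carrier G - {\<one>} \<noteq> {}"
    and deg: "\<And>u. u \<in> carrier G - {\<one>} \<Longrightarrow>
      card {w \<in> carrier G - {\<one>}.
        generate G {w} \<subset> generate G {u} \<or> generate G {u} \<subset> generate G {w}} = 2"
  shows False
proof -
  define N where "N u = {w \<in> carrier G - {\<one>}.
    generate G {w} \<subset> generate G {u} \<or> generate G {u} \<subset> generate G {w}}" for u
  have N2: "card (N u) = 2" if "u \<in> carrier G - {\<one>}" for u
    using deg[OF that] by (simp add: N_def)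
  obtain u w where "u \<in> carrier G - {\<one>}" "w \<in> N u"
    using nonempty N2 by (metis all_not_in_conv card.empty zero_neq_numeral)
  then obtain a v where a: "a \<in> carrier G" "a \<noteq> \<one>" and v: "v \<in> carrier G" "v \<noteq> \<one>"
    and av: "generate G {a} \<subset> generate G {v}"
    by (auto simp: N_def)
  let ?V = "generate G {v}"
  have sub: "subgroup ?V G"
    using v by (intro generate_is_subgroup) simp
  have aV: "a \<in> ?V"
    using av generate_subset_iff[OF a(1) v(1)] by auto
  have anv: "a \<noteq> v" "a \<noteq> inv v"
    using av generate_inv[OF v(1)] by auto
  have vinv: "v \<noteq> inv v"
  proof
    assume "v = inv v"
    then have "?V \<subseteq> {\<one>, v}"
      using generate_involution[of v] v by simp
    then show False
      using aV a anv by auto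
  qed
  have finN: "finite (N a)"
    using N2[of a] a by (intro card_ge_0_finite) simp
  have "{v, inv v} \<subseteq> N a"
    using v av generate_inv[OF v(1)] by (auto simp: N_def)
  then have Na: "N a = {v, inv v}"
    using card_subset_eq[OF finN, of "{v, inv v}"] vinv N2[of a] a by auto
  have "a \<in> N v"
    using a av by (simp add: N_def)
  then obtain c where Nv: "N v = {a, c}" and ac: "a \<noteq> c"
    using N2[of v] v unfolding card_2_iff by (metis DiffI empty_iff insertE insert_commute)
  have c: "c \<in> carrier G" "c \<noteq> \<one>"
    and comp: "generate G {c} \<subset> ?V \<or> ?V \<subset> generate G {c}"
    using Nv by (auto simp: N_def)
  \<comment> \<open>An element strictly above \<open>v\<close> would be a third neighbour of \<open>a\<close>.\<close>
  have cv: "generate G {c} \<subset> ?V"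
  proof (rule ccontr)
    assume "\<not> ?thesis"
    then have above: "?V \<subset> generate G {c}"
      using comp by simp
    then have "c \<in> N a"
      using c av by (auto simp: N_def)
    then have "generate G {c} = ?V"
      using Na generate_inv[OF v(1)] by auto
    then show False
      using above by simp
  qed
  have cV: "c \<in> ?V"
    using cv generate_subset_iff[OF c(1) v(1)] by auto
  have cnv: "c \<noteq> v" "c \<noteq> inv v"
    using cv generate_inv[OF v(1)] by auto
  have "?V = {\<one>, a, c, v, inv v}"
  proof
    show "{\<one>, a, c, v, inv v} \<subseteq> ?V"
      using aV cV by (auto intro: generate.intros)
    show "?V \<subseteq> {\<one>, a, c, v, inv v}"
    proof
      fix x assume x: "x \<in> ?V"
      then have xG: "x \<in> carrier G"
        using v generate_incl[of "{v}"] by auto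
      then have le: "generate G {x} \<subseteq> ?V"
        using x generate_subset_iff[OF _ v(1)] by simp
      show "x \<in> {\<one>, a, c, v, inv v}"
      proof (cases "x = \<one> \<or> generate G {x} \<noteq> ?V")
        case True
        then have "x = \<one> \<or> x \<in> N v"
          using le xG by (auto simp: N_def)
        then show ?thesis
          using Nv by auto
      next
        case False
        then have "x \<in> N a"
          using xG av by (auto simp: N_def)
        then show ?thesis
          using Na by auto
      qed
    qed
  qed
  moreover have "inv v \<noteq> \<one>"
    using v by simp
  ultimately have card5: "card ?V = 5"
    using a(2) c(2) v(2) ac anv cnv vinv by (simp add: eq_commute[of "\<one>"])
  have "prime (card ?V)"
    unfolding card5 by simp
  then have "generate G {a} = {\<one>} \<or> generate G {a} = ?V"
    using subgroup_of_prime_card[OF sub] generate_is_subgroup[of "{a}"] a av by auto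
  then show False
    using av a generate.incl[of a "{a}" G] by auto
qed

end

theorem corollary3p2:
  fixes G :: "('a, 'b) monoid_scheme" and n :: nat
  assumes "group G" and "finite (carrier G)" and "n \<ge> 3"
  shows "\<not> digraph_iso (with_proj (reduced_power_graph G)) (with_proj (cycle_graph n)) \<and>
    \<not> digraph_iso (proper_reduced_power_graph G) (with_proj (cycle_graph n))"
proof (intro conjI notI)
  interpret group G by (rule assms(1))
  show False if iso: "digraph_iso (with_proj (reduced_power_graph G)) (with_proj (cycle_graph n))"
  proof (rule reduced_power_graph_not_2_regular[OF assms(2)])
    fix u assume u: "u \<in> carrier G"
    then have "u \<in> verts (with_proj (reduced_power_graph G))"
      by (simp add: reduced_power_graph_def)
    from out_degree_of_iso_cycle_graph[OF iso assms(3) this]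
    show "card {w \<in> carrier G.
        generate G {w} \<subset> generate G {u} \<or> generate G {u} \<subset> generate G {w}} = 2"
      using u by (simp add: out_degree_reduced_power_graph)
  qed
  show False if iso: "digraph_iso (proper_reduced_power_graph G) (with_proj (cycle_graph n))"
  proof (rule proper_reduced_power_graph_not_2_regular)
    have V: "verts (proper_reduced_power_graph G) = carrier G - {\<one>\<^bsub>G\<^esub>}"
      by (simp add: proper_reduced_power_graph_def)
    show "carrier G - {\<one>\<^bsub>G\<^esub>} \<noteq> {}"
      using verts_nonempty_of_iso_cycle_graph[OF iso assms(3)] V by simp
    fix u assume u: "u \<in> carrier G - {\<one>\<^bsub>G\<^esub>}"
    from out_degree_of_iso_cycle_graph[OF iso assms(3), of u]
    show "card {w \<in> carrier G - {\<one>\<^bsub>G\<^esub>}.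
        generate G {w} \<subset> generate G {u} \<or> generate G {u} \<subset> generate G {w}} = 2"
      using u V out_degree_proper_reduced_power_graph[OF u] by simp
  qed
qed

end
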